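(* Let $G=(V,E)$ be a finite simple connected graph, and let $E_3(G)\subseteq E$ be the set of edges of $G$ that belong to some $3$-cycle (triangle) of $G$. Then \[ f_1(P_G)\;\geq\; |E|\,(2|V|-5)+|E_3(G)|, \] where $f_1(P_G)$ denotes the number of edges (one-dimensional faces) of the symmetric edge polytope $P_G$.
   Context: For a finite simple graph $G$ on vertex set $[n]$ with edge set $E$, the symmetric edge polytope is $P_G:=\operatorname{conv}\{\pm(e_i-e_j): \{i,j\}\in E\}\subseteq\mathbb{R}^n$, where $e_1,\dots,e_n$ are the standard basis vectors. *)

theory Defs
  imports "HOL-Analysis.Analysis"
begin

text \<open>A finite simple graph with vertex set all of the finite type \<open>'n\<close> is given by its edge set,
  a set of two-element sets of vertices. The ambient space of the polytope is then \<open>real ^ 'n\<close>.\<close>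

definition simple_graph :: "'n::finite set set \<Rightarrow> bool" where
  "simple_graph E \<longleftrightarrow> (\<forall>e\<in>E. card e = 2)"

definition connected_graph :: "'n::finite set set \<Rightarrow> bool" where
  "connected_graph E \<longleftrightarrow> (\<forall>u v. (u, v) \<in> {(i, j). {i, j} \<in> E}\<^sup>*)"

definition triangle_edges :: "'n::finite set set \<Rightarrow> 'n set set" where
  "triangle_edges E = {e \<in> E. \<exists>i j k. i \<noteq> j \<and> j \<noteq> k \<and> i \<noteq> k \<and>
     {{i, j}, {j, k}, {i, k}} \<subseteq> E \<and> e \<in> {{i, j}, {j, k}, {i, k}}}"

definition symmetric_edge_polytope :: "'n::finite set set \<Rightarrow> (real ^ 'n) set" where
  "symmetric_edge_polytope E = convex hull
     (\<Union>(i, j) \<in> {(i, j). {i, j} \<in> E}. {axis i 1 - axis j 1, - (axis i 1 - axis j 1)})"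

text \<open>The library's \<open>F edge_of P\<close> means that \<open>F\<close> is a face of \<open>P\<close> of affine dimension one; it does
  not require \<open>F\<close> to be a proper face.\<close>

definition num_edges :: "(real ^ 'n::finite) set \<Rightarrow> nat" where
  "num_edges P = card {F. F edge_of P}"

end

theory Submission
  imports Defs
begin

text \<open>A linear functional exposing two arcs shows that the segment between the vertices
  \<open>e\<^sub>i - e\<^sub>j\<close> and \<open>e\<^sub>k - e\<^sub>l\<close> is an edge of the polytope unless \<open>e\<^sub>i - e\<^sub>j + e\<^sub>k - e\<^sub>l\<close>
  can be rewritten through a triangle or a 4-cycle. For an arc \<open>(i, j)\<close>, the number of arcs lost in
  this way is controlled by the cycle rank of the union \<open>S\<close> of the triangles and 4-cycles through
  \<open>{i, j}\<close>: if \<open>G\<close> has cycle rank \<open>\<mu>\<close> and \<open>\<kappa>\<close> counts the groups of 4-cycles through \<open>{i, j}\<close> that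
  are attached to no triangle, the degree of \<open>(i, j)\<close> is at least \<open>2|V| - 4 + 2(\<mu> - \<mu>(S)) - \<kappa>\<close>. So an arc
  can fall short of the average \<open>2|V| - 5 + [{i, j} lies in a triangle]\<close> by \<open>k = \<kappa> + [triangle] - 1\<close>.
  But for the edge \<open>e\<close> with the largest \<open>k > 0\<close>, at most one of the \<open>k + 1\<close> groups of short cycles through
  \<open>e\<close> can be absorbed by the short cycles through another edge \<open>f\<close>; hence \<open>\<mu> - \<mu>(S) \<ge> k\<close> for \<open>f\<close>,
  every other edge has surplus at least \<open>k\<close>, and one of them pays for \<open>e\<close>.\<close>

section \<open>Counting in graphs; edges of a convex hull\<close>

lemma card_ordered_pairs:
  fixes X :: "'a set set"
  assumes "finite X" "\<And>e. e \<in> X \<Longrightarrow> card e = 2"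
  shows "card {(u, v). {u, v} \<in> X} = 2 * card X"
proof -
  have fib: "card {(u, v). {u, v} = e} = 2" if e: "e \<in> X" for e
  proof -
    obtain p q where "e = {p, q}" "p \<noteq> q" using assms(2)[OF e] by (auto simp: card_2_iff)
    then have "{(u, v). {u, v} = e} = {(p, q), (q, p)}" by (auto simp: doubleton_eq_iff)
    then show ?thesis using \<open>p \<noteq> q\<close> by simp
  qed
  have fin: "finite {(u, v). {u, v} = e}" if "e \<in> X" for e
    using fib[OF that] by (metis card.infinite zero_neq_numeral)
  have "{(u, v). {u, v} \<in> X} = (\<Union>e\<in>X. {(u, v). {u, v} = e})" by auto
  also have "card \<dots> = (\<Sum>e\<in>X. card {(u, v). {u, v} = e})"
    using assms(1) fin by (intro card_UN_disjoint) auto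
  also have "\<dots> = 2 * card X" using fib by simp
  finally show ?thesis .
qed

text \<open>Growing \<open>R\<close> along an edge that leaves it gains one vertex, and that edge
  lies inside \<open>R\<close> from then on: each new vertex is charged to its own edge.\<close>

lemma card_diff_le_edges:
  fixes F :: "'a set set"
  assumes "finite F" "finite W"
    and "\<And>v. v \<in> W \<Longrightarrow> \<exists>r\<in>R. (r, v) \<in> {(u, v). {u, v} \<in> F}\<^sup>*"
  shows "card (W - R) \<le> card {g \<in> F. \<not> g \<subseteq> R}"
  using assms(3)
proof (induction "card {g \<in> F. \<not> g \<subseteq> R}" arbitrary: R rule: less_induct)
  case less
  show ?case
  proof (cases "W \<subseteq> R")
    case True
    then have "W - R = {}" by auto
    then show ?thesis by (metis card.empty le0)
  next
    case False
    then obtain w where w: "w \<in> W" "w \<notin> R" by auto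
    obtain r where r: "r \<in> R" "(r, w) \<in> {(u, v). {u, v} \<in> F}\<^sup>*" using less.prems w by auto
    have "\<exists>u v. u \<in> R \<and> v \<notin> R \<and> {u, v} \<in> F"
      using r(2) r(1) w(2) by (induction rule: rtrancl_induct) auto
    then obtain u v where uv: "u \<in> R" "v \<notin> R" "{u, v} \<in> F" by auto
    let ?S = "\<lambda>R. {g \<in> F. \<not> g \<subseteq> R}"
    have sub: "?S (insert v R) \<subset> ?S R"
    proof (rule psubsetI)
      show "?S (insert v R) \<subseteq> ?S R" by auto
      have "{u, v} \<in> ?S R" "{u, v} \<notin> ?S (insert v R)" using uv by simp_all
      then show "?S (insert v R) \<noteq> ?S R" by metis
    qed
    have lt: "card (?S (insert v R)) < card (?S R)"
      using sub assms(1) by (intro psubset_card_mono) auto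
    have "card (W - insert v R) \<le> card (?S (insert v R))"
      using less.prems by (intro less.hyps[OF lt]) blast
    moreover have "card (W - R) \<le> Suc (card (W - insert v R))"
    proof -
      have "W - R \<subseteq> insert v (W - insert v R)" by auto
      then have "card (W - R) \<le> card (insert v (W - insert v R))"
        using assms(2) by (intro card_mono) auto
      also have "\<dots> \<le> Suc (card (W - insert v R))" using assms(2) by (simp add: card_insert_if)
      finally show ?thesis .
    qed
    ultimately show ?thesis using lt by linarith
  qed
qed

lemma exists_transversal:
  assumes "finite X" "sym r" "\<And>x. (x, x) \<in> r"
  shows "\<exists>U\<subseteq>X. (\<forall>u\<in>U. \<forall>v\<in>U. (u, v) \<in> r \<longrightarrow> u = v) \<and> (\<forall>x\<in>X. \<exists>u\<in>U. (u, x) \<in> r)"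
  using assms(1)
proof (induction X)
  case (insert x X)
  then obtain U where U: "U \<subseteq> X" "\<forall>u\<in>U. \<forall>v\<in>U. (u, v) \<in> r \<longrightarrow> u = v" "\<forall>x\<in>X. \<exists>u\<in>U. (u, x) \<in> r"
    by auto
  show ?case
  proof (cases "\<exists>u\<in>U. (u, x) \<in> r")
    case True
    then show ?thesis using U by (intro exI[of _ U]) auto
  next
    case False
    then have "\<forall>u\<in>U. (x, u) \<notin> r" using assms(2) by (auto dest: symD)
    then show ?thesis using U False assms(3) by (intro exI[of _ "insert x U"]) auto
  qed
qed auto

text \<open>A supporting hyperplane cuts out the hull of the generators on it, and strictness leaves
  only \<open>p\<close> and \<open>q\<close>.\<close>

lemma closed_segment_edge_of_convex_hull:
  fixes S :: "'a::euclidean_space set"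
  assumes S: "finite S" "p \<in> S" "q \<in> S" "p \<noteq> q"
    and "w \<bullet> p = c" "w \<bullet> q = c"
    and lt: "\<And>x. x \<in> S \<Longrightarrow> x \<noteq> p \<Longrightarrow> x \<noteq> q \<Longrightarrow> w \<bullet> x < c"
  shows "closed_segment p q edge_of convex hull S"
proof -
  have "S \<subseteq> {x. w \<bullet> x \<le> c}" using assms by (force simp: less_imp_le)
  then have le: "convex hull S \<subseteq> {x. w \<bullet> x \<le> c}"
    by (rule hull_minimal) (rule convex_halfspace_le)
  let ?F = "convex hull S \<inter> {x. w \<bullet> x = c}"
  have face: "?F face_of convex hull S"
    using le by (intro face_of_Int_supporting_hyperplane_le) (auto simp: convex_convex_hull)
  obtain s where s: "s \<subseteq> S" "?F = convex hull s"
    using face_of_convex_hull_subset[OF finite_imp_compact[OF S(1)] face] by auto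
  have "s \<subseteq> ?F" unfolding s(2) by (rule hull_subset)
  then have "s \<subseteq> {p, q}" using s(1) lt by fastforce
  then have "?F \<subseteq> convex hull {p, q}" unfolding s(2) by (rule hull_mono)
  moreover have "convex hull {p, q} \<subseteq> ?F"
    using assms face by (intro hull_minimal face_of_imp_convex) (auto simp: hull_inc)
  ultimately have "?F = closed_segment p q" by (simp add: segment_convex_hull)
  moreover have "aff_dim (closed_segment p q) = 1"
    using S(4) by (simp add: segment_convex_hull aff_dim_convex_hull aff_dim_2)
  ultimately show ?thesis using face by (simp add: edge_of_def)
qed

section \<open>Arcs and their vectors\<close>

locale finite_graph =
  fixes E :: "'n::finite set set"
  assumes simple: "simple_graph E"
begin

definition adj :: "'n \<Rightarrow> 'n \<Rightarrow> bool" where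
  "adj u v \<longleftrightarrow> {u, v} \<in> E"

lemma adj_sym: "adj u v \<longleftrightarrow> adj v u"
  by (simp add: adj_def insert_commute)

lemma adj_irrefl: "\<not> adj u u"
  using simple by (force simp: adj_def simple_graph_def)

definition arcs :: "('n \<times> 'n) set" where
  "arcs = {(u, v). {u, v} \<in> E}"

lemma mem_arcs: "(u, v) \<in> arcs \<longleftrightarrow> adj u v"
  by (simp add: arcs_def adj_def)

definition arc_vec :: "'n \<times> 'n \<Rightarrow> real ^ 'n" where
  "arc_vec \<alpha> = axis (fst \<alpha>) 1 - axis (snd \<alpha>) 1"

lemma inner_arc_vec: "(\<chi> v. \<phi> v) \<bullet> arc_vec (u, v) = \<phi> u - \<phi> v"
  by (simp add: arc_vec_def inner_diff_right inner_axis)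

lemma arc_vec_inj: "inj_on arc_vec arcs"
proof (rule inj_onI, clarify)
  fix u v u' v' assume *: "(u, v) \<in> arcs" "(u', v') \<in> arcs" "arc_vec (u, v) = arc_vec (u', v')"
  have ne: "u \<noteq> v" "u' \<noteq> v'" using * adj_irrefl by (auto simp: mem_arcs)
  have "arc_vec (u, v) $ u = arc_vec (u', v') $ u" "arc_vec (u, v) $ v = arc_vec (u', v') $ v"
    using *(3) by auto
  then show "u = u' \<and> v = v'" using ne by (auto simp: arc_vec_def axis_def split: if_splits)
qed

lemma polytope_eq: "symmetric_edge_polytope E = convex hull (arc_vec ` arcs)"
proof -
  have "(\<Union>(i, j) \<in> {(i, j). {i, j} \<in> E}. {axis i 1 - axis j 1, - (axis i 1 - axis j 1)}) = arc_vec ` arcs"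
    (is "?L = ?R")
  proof
    show "?L \<subseteq> ?R"
    proof
      fix x assume "x \<in> ?L"
      then obtain i j where "adj i j" "x = arc_vec (i, j) \<or> x = arc_vec (j, i)"
        by (auto simp: arc_vec_def adj_def)
      then show "x \<in> ?R" by (metis adj_sym image_eqI mem_arcs)
    qed
    show "?R \<subseteq> ?L" by (auto simp: arc_vec_def arcs_def)
  qed
  then show ?thesis by (simp add: symmetric_edge_polytope_def)
qed

text \<open>A linear functional is a potential \<phi>, with the potential drop as its value on an
  arc; two arcs are exposed when they alone drop the most.\<close>

lemma segment_edge_of_polytope:
  fixes \<phi> :: "'n \<Rightarrow> real"
  assumes "adj i j" "adj k l" "(i, j) \<noteq> (k, l)"
    and "\<phi> i - \<phi> j = c" "\<phi> k - \<phi> l = c"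
    and lt: "\<And>u v. adj u v \<Longrightarrow> (u, v) \<noteq> (i, j) \<Longrightarrow> (u, v) \<noteq> (k, l) \<Longrightarrow> \<phi> u - \<phi> v < c"
  shows "closed_segment (arc_vec (i, j)) (arc_vec (k, l)) edge_of symmetric_edge_polytope E"
  unfolding polytope_eq
proof (rule closed_segment_edge_of_convex_hull)
  show "finite (arc_vec ` arcs)" by simp
  show "arc_vec (i, j) \<noteq> arc_vec (k, l)"
    using assms arc_vec_inj by (auto simp: mem_arcs dest: inj_onD)
  fix x assume x: "x \<in> arc_vec ` arcs" "x \<noteq> arc_vec (i, j)" "x \<noteq> arc_vec (k, l)"
  then obtain u v where "x = arc_vec (u, v)" "adj u v" by (auto simp: mem_arcs)
  then show "(\<chi> v. \<phi> v) \<bullet> x < c" using lt[of u v] x by (auto simp: inner_arc_vec)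
qed (use assms in \<open>auto simp: mem_arcs inner_arc_vec\<close>)

section \<open>Short cycles through an edge and edges of the polytope\<close>

definition common :: "'n \<Rightarrow> 'n \<Rightarrow> 'n set" where
  "common i j = {c. adj i c \<and> adj j c}"

text \<open>For adjacent \<open>i\<close> and \<open>j\<close>, these are the neighbours \<open>a\<close> of \<open>i\<close> such that the edge
  \<open>{i, a}\<close> lies together with \<open>{i, j}\<close> in a triangle or a 4-cycle.\<close>

definition near :: "'n \<Rightarrow> 'n \<Rightarrow> 'n set" where
  "near i j = {a. a \<noteq> j \<and> adj i a \<and> (adj j a \<or> (\<exists>p. p \<noteq> i \<and> adj j p \<and> adj p a))}"

text \<open>The arc \<open>(k, l)\<close> is opposite to \<open>(i, j)\<close> in the 4-cycle i, j,
  k, l, directed so that the vectors of \<open>(i, l)\<close> and \<open>(k, j)\<close> have the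
  same sum as those of \<open>(i, j)\<close> and \<open>(k, l)\<close>.\<close>

definition cross :: "'n \<Rightarrow> 'n \<Rightarrow> ('n \<times> 'n) set" where
  "cross i j = {(k, l). k \<noteq> i \<and> l \<noteq> j \<and> adj k l \<and> adj i l \<and> adj j k}"

definition cross_edges :: "'n \<Rightarrow> 'n \<Rightarrow> 'n set set" where
  "cross_edges i j = (\<lambda>(k, l). {k, l}) ` cross i j"

text \<open>The arcs \<open>(k, l)\<close> for which \<open>e\<^sub>i - e\<^sub>j + e\<^sub>k - e\<^sub>l\<close> has another expression of total weight at
  most two; only these can fail to span an edge of the polytope with \<open>(i, j)\<close>.\<close>

definition killed :: "'n \<Rightarrow> 'n \<Rightarrow> ('n \<times> 'n) set" where
  "killed i j = Pair j ` near j i \<union> (\<lambda>a. (a, i)) ` near i j \<union> cross i j"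

definition nbrs :: "'n \<times> 'n \<Rightarrow> ('n \<times> 'n) set" where
  "nbrs = (\<lambda>(i, j). arcs - {(i, j), (j, i)} - killed i j)"

text \<open>The cases are the ways in which two arcs can share a vertex; arcs with a common tail or
  a common head are exposed whatever the other edges are.\<close>

lemma nbrs_edge_of_polytope:
  assumes "adj i j" "(k, l) \<in> nbrs (i, j)"
  shows "closed_segment (arc_vec (i, j)) (arc_vec (k, l)) edge_of symmetric_edge_polytope E"
proof -
  have kl: "adj k l" "(i, j) \<noteq> (k, l)" "(k, l) \<noteq> (j, i)" "(k, l) \<notin> killed i j"
    using assms by (auto simp: nbrs_def mem_arcs)
  have ne: "i \<noteq> j" "k \<noteq> l" using adj_irrefl assms(1) kl(1) by auto
  \<comment> \<open>Without a chord or a second middle vertex, the neighbours of p other than q can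
    sit at 1 and those of r at -1, which keeps every other drop at 3 or less.\<close>
  have through: "closed_segment (arc_vec (p, q)) (arc_vec (q, r)) edge_of symmetric_edge_polytope E"
    if pqr: "adj p q" "adj q r" "p \<noteq> r" "\<not> adj p r" "\<And>z. z \<noteq> q \<Longrightarrow> adj p z \<Longrightarrow> \<not> adj z r" for p q r
  proof -
    have pq: "p \<noteq> q" "q \<noteq> r" using pqr adj_irrefl by auto
    let ?\<phi> = "\<lambda>v. if v = p then 4 else if v = r then -4 else if v = q then 0 else
      if adj p v then 1 else if adj v r then -1 else (0::real)"
    show ?thesis
    proof (rule segment_edge_of_polytope[where \<phi> = ?\<phi> and c = 4])
      fix u v assume uv: "adj u v" "(u, v) \<noteq> (p, q)" "(u, v) \<noteq> (q, r)"
      have "u \<noteq> v" using uv adj_irrefl by auto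
      show "?\<phi> u - ?\<phi> v < 4"
        using pqr(3-5) pq uv \<open>u \<noteq> v\<close> adj_sym by (auto split: if_splits)
    qed (use pqr pq in auto)
  qed
  \<comment> \<open>Only an arc from p to s would drop by more than 4, so the absence of this one
    diagonal suffices.\<close>
  have disj: "closed_segment (arc_vec (p, q)) (arc_vec (r, s)) edge_of symmetric_edge_polytope E"
    if pq: "adj p q" "adj r s" "\<not> adj p s" "p \<noteq> r" "p \<noteq> s" "q \<noteq> r" "q \<noteq> s" for p q r s
  proof -
    have pq': "p \<noteq> q" "r \<noteq> s" using pq adj_irrefl by auto
    let ?\<phi> = "\<lambda>v. if v = p then 3 else if v = q then -1 else if v = r then 1 else if v = s then -3
      else (0::real)"
    show ?thesis
    proof (rule segment_edge_of_polytope[where \<phi> = ?\<phi> and c = 4])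
      fix u v assume uv: "adj u v" "(u, v) \<noteq> (p, q)" "(u, v) \<noteq> (r, s)"
      have "u \<noteq> v" using uv adj_irrefl by auto
      show "?\<phi> u - ?\<phi> v < 4"
        using pq(3-7) pq' uv \<open>u \<noteq> v\<close> by (auto split: if_splits)
    qed (use pq pq' in auto)
  qed
  consider "k = i" "l \<noteq> j" | "l = j" "k \<noteq> i" | "k = j" "l \<noteq> i" | "l = i" "k \<noteq> j"
    | "k \<noteq> i" "k \<noteq> j" "l \<noteq> i" "l \<noteq> j" using kl(2,3) by auto
  then show ?thesis
  proof cases
    case 1
    let ?\<phi> = "\<lambda>v. if v = i then 1 else if v = j \<or> v = l then -1 else (0::real)"
    show ?thesis
      by (rule segment_edge_of_polytope[where \<phi> = ?\<phi> and c = 2])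
        (use 1 kl ne assms in \<open>auto split: if_splits\<close>)
  next
    case 2
    let ?\<phi> = "\<lambda>v. if v = j then -1 else if v = i \<or> v = k then 1 else (0::real)"
    show ?thesis
      by (rule segment_edge_of_polytope[where \<phi> = ?\<phi> and c = 2])
        (use 2 kl ne assms in \<open>auto split: if_splits\<close>)
  next
    case 3
    then have "l \<notin> near j i" using kl by (auto simp: killed_def)
    then have "\<not> adj i l" "\<And>z. z \<noteq> j \<Longrightarrow> adj i z \<Longrightarrow> \<not> adj z l"
      using 3 kl unfolding near_def by auto
    then show ?thesis using through[of i j l] 3 kl assms by auto
  next
    case 4
    then have "k \<notin> near i j" using kl by (auto simp: killed_def)
    then have "\<not> adj k j" "\<And>z. z \<noteq> i \<Longrightarrow> adj k z \<Longrightarrow> \<not> adj z j"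
      using 4 kl adj_sym unfolding near_def by blast+
    then have "closed_segment (arc_vec (k, i)) (arc_vec (i, j)) edge_of symmetric_edge_polytope E"
      using through[of k i j] 4 kl assms by auto
    then show ?thesis using 4 by (simp add: closed_segment_commute)
  next
    case 5
    have "\<not> adj i l \<or> \<not> adj k j" using 5 kl adj_sym by (auto simp: killed_def cross_def)
    then show ?thesis
    proof
      assume "\<not> adj i l"
      then show ?thesis using disj[of i j k l] 5 kl assms by auto
    next
      assume "\<not> adj k j"
      then have "closed_segment (arc_vec (k, l)) (arc_vec (i, j)) edge_of symmetric_edge_polytope E"
        using disj[of k l i j] 5 kl assms by auto
      then show ?thesis by (simp add: closed_segment_commute)
    qed
  qed
qed

text \<open>Segments determine their endpoints, so distinct pairs of arcs give distinct edges, and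
  each unordered pair is counted at most twice.\<close>

lemma sum_nbrs_le_num_edges:
  "(\<Sum>\<alpha>\<in>arcs. card (nbrs \<alpha>)) \<le> 2 * num_edges (symmetric_edge_polytope E)"
proof -
  let ?P = "symmetric_edge_polytope E"
  let ?D = "Sigma arcs nbrs"
  let ?X = "(\<lambda>(\<alpha>, \<beta>). {\<alpha>, \<beta>}) ` ?D"
  have D: "\<alpha> \<in> arcs \<and> \<beta> \<in> arcs \<and> \<alpha> \<noteq> \<beta>" if "(\<alpha>, \<beta>) \<in> ?D" for \<alpha> \<beta>
    using that by (auto simp: nbrs_def)
  have "(\<Sum>\<alpha>\<in>arcs. card (nbrs \<alpha>)) = card ?D" by (simp add: card_SigmaI)
  also have "\<dots> \<le> card {(\<alpha>, \<beta>). {\<alpha>, \<beta>} \<in> ?X}" by (intro card_mono) auto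
  also have "\<dots> = 2 * card ?X" using D by (intro card_ordered_pairs) auto
  also have "card ?X \<le> card {F. F edge_of ?P}"
  proof (rule card_inj_on_le)
    let ?s = "\<lambda>A. convex hull (arc_vec ` A)"
    have seg: "?s {\<alpha>, \<beta>} = closed_segment (arc_vec \<alpha>) (arc_vec \<beta>)" for \<alpha> \<beta>
      by (simp add: segment_convex_hull)
    show "inj_on ?s ?X"
    proof (rule inj_onI)
      fix A B assume "A \<in> ?X" "B \<in> ?X" and eq: "?s A = ?s B"
      then obtain \<alpha> \<beta> \<gamma> \<delta> where A: "A = {\<alpha>, \<beta>}" "(\<alpha>, \<beta>) \<in> ?D" and B: "B = {\<gamma>, \<delta>}" "(\<gamma>, \<delta>) \<in> ?D"
        by (elim imageE) auto
      have "arc_vec ` A = arc_vec ` B" using eq unfolding A B seg by (simp add: closed_segment_eq)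
      moreover have "A \<subseteq> arcs" "B \<subseteq> arcs" using D[OF A(2)] D[OF B(2)] unfolding A(1) B(1) by auto
      ultimately show "A = B" using inj_on_image_eq_iff[OF arc_vec_inj] by simp
    qed
    show "?s ` ?X \<subseteq> {F. F edge_of ?P}"
    proof clarify
      fix i j k l assume "(i, j) \<in> arcs" "(k, l) \<in> nbrs (i, j)"
      then show "?s {(i, j), (k, l)} edge_of ?P"
        unfolding seg by (intro nbrs_edge_of_polytope) (auto simp: mem_arcs)
    qed
    have "finite {F. F face_of ?P}"
      unfolding polytope_eq by (intro finite_polytope_faces polytope_convex_hull) simp
    then show "finite {F. F edge_of ?P}" by (rule rev_finite_subset) (auto simp: edge_of_def)
  qed
  finally show ?thesis by (simp add: num_edges_def)
qed

section \<open>Groups of short cycles through an edge\<close>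

text \<open>Connectivity in the graph of cross edges. Short cycles through \<open>{i, j}\<close>
  form one group when their vertices other than i and j lie in one class.\<close>

definition reach :: "'n \<Rightarrow> 'n \<Rightarrow> ('n \<times> 'n) set" where
  "reach i j = {(u, v). {u, v} \<in> cross_edges i j}\<^sup>*"

lemma sym_reach: "sym (reach i j)"
  unfolding reach_def by (intro sym_rtrancl) (auto simp: sym_def insert_commute)

lemma reach_refl: "(u, u) \<in> reach i j"
  by (simp add: reach_def)

lemma reach_trans: "(u, v) \<in> reach i j \<Longrightarrow> (v, w) \<in> reach i j \<Longrightarrow> (u, w) \<in> reach i j"
  by (simp add: reach_def)

lemma cross_step:
  assumes "adj i u" "u \<noteq> j" "adj j v" "v \<noteq> i" "adj u v"
  shows "(u, v) \<in> reach i j" "(v, u) \<in> reach i j"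
proof -
  have "(v, u) \<in> cross i j" using assms adj_sym by (auto simp: cross_def)
  then have "{v, u} \<in> cross_edges i j" by (force simp: cross_edges_def)
  then show "(u, v) \<in> reach i j" "(v, u) \<in> reach i j"
    by (auto simp: reach_def insert_commute intro!: r_into_rtrancl)
qed

text \<open>One vertex near \<open>i\<close> for each connected component of the graph of cross edges that contains no
  common neighbour of \<open>i\<close> and \<open>j\<close>; the cardinality of such a set is \<open>\<kappa>\<close>.\<close>

definition transversal :: "'n \<Rightarrow> 'n \<Rightarrow> 'n set \<Rightarrow> bool" where
  "transversal i j U \<longleftrightarrow> U \<subseteq> near i j \<and> (\<forall>u\<in>U. \<forall>v\<in>U. (u, v) \<in> reach i j \<longrightarrow> u = v) \<and>
     (\<forall>u\<in>U. \<forall>c\<in>common i j. (c, u) \<notin> reach i j) \<and>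
     (\<forall>a\<in>near i j \<union> near j i. \<exists>r\<in>common i j \<union> U. (r, a) \<in> reach i j)"

text \<open>Representatives near i suffice: a vertex of \<open>near j i\<close> is a common
  neighbour or is joined by a cross edge to a vertex of \<open>near i j\<close>.\<close>

lemma exists_transversal_near: "\<exists>U. transversal i j U"
proof -
  let ?X = "{a \<in> near i j. \<forall>c\<in>common i j. (c, a) \<notin> reach i j}"
  obtain U where U: "U \<subseteq> ?X" "\<forall>u\<in>U. \<forall>v\<in>U. (u, v) \<in> reach i j \<longrightarrow> u = v"
    "\<forall>x\<in>?X. \<exists>u\<in>U. (u, x) \<in> reach i j"
    using exists_transversal[of ?X "reach i j"] sym_reach reach_refl by auto
  have left: "\<exists>r\<in>common i j \<union> U. (r, a) \<in> reach i j" if "a \<in> near i j" for a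
    using U(3) that by blast
  have right: "\<exists>r\<in>common i j \<union> U. (r, b) \<in> reach i j" if b: "b \<in> near j i" for b
  proof (cases "b \<in> common i j")
    case True
    then show ?thesis using reach_refl by blast
  next
    case False
    then obtain p where p: "p \<noteq> j" "adj i p" "adj p b" "b \<noteq> i" "adj j b"
      using b by (auto simp: near_def common_def)
    then have "p \<in> near i j" using adj_sym unfolding near_def by blast
    then obtain r where "r \<in> common i j \<union> U" "(r, p) \<in> reach i j" using left by blast
    then show ?thesis using cross_step(1)[of i p j b] p reach_trans by blast
  qed
  have "transversal i j U"
    unfolding transversal_def
  proof (intro conjI)
    show "\<forall>a\<in>near i j \<union> near j i. \<exists>r\<in>common i j \<union> U. (r, a) \<in> reach i j"
      using left right by (metis UnE)
  qed (use U(1,2) in auto)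
  then show ?thesis by blast
qed

text \<open>The union of the triangles and 4-cycles through \<open>{i, j}\<close>.\<close>

definition support :: "'n \<Rightarrow> 'n \<Rightarrow> 'n set set" where
  "support i j = insert {i, j}
     ((\<lambda>a. {i, a}) ` near i j \<union> (\<lambda>b. {j, b}) ` near j i \<union> cross_edges i j)"

lemma near_Int: "adj i j \<Longrightarrow> near i j \<inter> near j i = common i j"
  by (auto simp: near_def common_def adj_irrefl)

lemma cross_near:
  assumes "(k, l) \<in> cross i j"
  shows "k \<in> near j i" "l \<in> near i j"
proof -
  have "k \<noteq> i" "l \<noteq> j" "adj k l" "adj l k" "adj i l" "adj j k"
    using assms adj_sym[of k l] by (auto simp: cross_def)
  then show "k \<in> near j i" "l \<in> near i j" by (auto simp: near_def)
qed

lemma card_support: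
  assumes "adj i j"
  shows "card (support i j) = 1 + card (near i j) + card (near j i) + card (cross_edges i j)"
proof -
  let ?A = "(\<lambda>a. {i, a}) ` near i j" and ?B = "(\<lambda>b. {j, b}) ` near j i" and ?H = "cross_edges i j"
  have ij: "i \<noteq> j" using assms adj_irrefl by auto
  have "card ?A = card (near i j)" "card ?B = card (near j i)"
    by (auto intro!: card_image inj_onI simp: doubleton_eq_iff)
  moreover have H: "i \<notin> g \<and> j \<notin> g" if "g \<in> ?H" for g
    using that adj_irrefl by (auto simp: cross_edges_def cross_def)
  moreover have "?A \<inter> ?B = {}" using ij by (auto simp: doubleton_eq_iff near_def)
  moreover have "(?A \<union> ?B) \<inter> ?H = {}" using H by auto
  moreover have "{i, j} \<notin> ?A \<union> ?B \<union> ?H" using H by (auto simp: doubleton_eq_iff near_def)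
  ultimately show ?thesis unfolding support_def by (simp add: card_Un_disjoint)
qed

lemma support_subset:
  assumes "adj i j"
  shows "support i j \<subseteq> E"
proof -
  have "cross_edges i j \<subseteq> E" by (auto simp: cross_edges_def cross_def adj_def)
  moreover have "{i, a} \<in> E" if "a \<in> near i j" for a i j using that by (simp add: near_def adj_def)
  moreover have "{i, j} \<in> E" using assms by (simp add: adj_def)
  ultimately show ?thesis by (auto simp: support_def)
qed

text \<open>A cross edge has both of its orientations in \<open>cross\<close> only if both ends are
  common neighbours of i and j, hence the weights 1 and 2.\<close>

lemma card_cross:
  "card (cross i j) \<le> card {g \<in> cross_edges i j. \<not> g \<subseteq> common i j}
     + 2 * card {g \<in> cross_edges i j. g \<subseteq> common i j}"
proof -
  let ?C = "common i j \<times> common i j"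
  let ?n = "{g \<in> cross_edges i j. \<not> g \<subseteq> common i j}" and ?c = "{g \<in> cross_edges i j. g \<subseteq> common i j}"
  have "card (cross i j - ?C) \<le> card ?n"
  proof (rule card_inj_on_le)
    show "inj_on (\<lambda>(k, l). {k, l}) (cross i j - ?C)"
      by (rule inj_onI) (auto simp: doubleton_eq_iff cross_def common_def)
    show "(\<lambda>(k, l). {k, l}) ` (cross i j - ?C) \<subseteq> ?n" by (auto simp: cross_edges_def)
  qed simp
  moreover have "card (cross i j \<inter> ?C) \<le> 2 * card ?c"
  proof -
    have "card (cross i j \<inter> ?C) \<le> card {(u, v). {u, v} \<in> ?c}"
      by (intro card_mono) (auto simp: cross_edges_def)
    also have "\<dots> = 2 * card ?c"
    proof (rule card_ordered_pairs)
      fix e assume "e \<in> ?c"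
      then have "e \<in> E" by (auto simp: cross_edges_def cross_def adj_def)
      then show "card e = 2" using simple by (simp add: simple_graph_def)
    qed simp
    finally show ?thesis .
  qed
  moreover have "card (cross i j) = card (cross i j \<inter> ?C) + card (cross i j - ?C)"
    by (rule card_Int_Diff) simp
  ultimately show ?thesis by linarith
qed

section \<open>Lower bound for the degree of an arc\<close>

lemma card_arcs: "card arcs = 2 * card E"
  unfolding arcs_def using simple by (intro card_ordered_pairs) (auto simp: simple_graph_def)

text \<open>\<open>T\<close> witnesses that \<mu> - \<mu>(S) is at least \<open>card T\<close>: its
  removal keeps the graph connected and the support intact. One spanning count bounds
  \<open>card E\<close> from below, another bounds the killed arcs from above.\<close>

lemma degree_bound:
  assumes ij: "adj i j" and U: "transversal i j U"
    and T: "T \<subseteq> E" "T \<inter> support i j = {}" "connected_graph (E - T)"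
  shows "2 * CARD('n) + 2 * card T \<le> card (nbrs (i, j)) + card U + 4"
proof -
  let ?N = "near i j \<union> near j i" and ?C = "common i j" and ?H = "cross_edges i j"
  let ?V = "{i, j} \<union> ?N"
  let ?n = "{g \<in> ?H. \<not> g \<subseteq> ?C}" and ?c = "{g \<in> ?H. g \<subseteq> ?C}"
  have N: "card (near i j) + card (near j i) = card ?N + card ?C"
    using card_Un_Int[of "near i j" "near j i"] near_Int[OF ij] by simp
  have "card (UNIV - ?V) \<le> card {g \<in> E - T. \<not> g \<subseteq> ?V}"
    using T(3) by (intro card_diff_le_edges) (auto simp: connected_graph_def)
  moreover have "card (support i j) \<le> card {g \<in> E - T. g \<subseteq> ?V}"
    using support_subset[OF ij] T(2) cross_near
    by (intro card_mono) (auto simp: support_def cross_edges_def)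
  moreover have "card (E - T) = card {g \<in> E - T. g \<subseteq> ?V} + card {g \<in> E - T. \<not> g \<subseteq> ?V}"
    using card_Int_Diff[of "E - T" "Pow ?V"] by (simp add: Int_def set_diff_eq Pow_def)
  moreover have "card (E - T) = card E - card T" "card T \<le> card E"
    using T(1) by (auto intro: card_Diff_subset card_mono)
  moreover have "card (UNIV - ?V) = CARD('n) - card ?V" "card ?V \<le> CARD('n)"
    by (auto intro: card_Diff_subset card_mono)
  moreover have "card ?V \<le> 2 + card ?N"
    by (rule order_trans[OF card_Un_le]) (simp add: card_insert_if)
  \<comment> \<open>Support edges lie inside \<open>?V\<close>, and the other vertices cost one edge
    each; the terms \<open>card ?N\<close> cancel.\<close>
  ultimately have E: "CARD('n) + card ?C + card ?H + card T \<le> card E + 1"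
    using card_support[OF ij] N by linarith
  \<comment> \<open>Every vertex of \<open>?N\<close> hangs on a root in \<open>?C\<close> or
    \<open>U\<close> over cross edges, so each one that is not a root costs a cross edge not inside
    \<open>?C\<close>.\<close>
  have "card (?N - (?C \<union> U)) \<le> card {g \<in> ?H. \<not> g \<subseteq> ?C \<union> U}"
    using U by (intro card_diff_le_edges) (auto simp: transversal_def reach_def)
  also have "\<dots> \<le> card ?n" by (intro card_mono) auto
  finally have "card (?N - (?C \<union> U)) \<le> card ?n" .
  moreover have "card ?N \<le> card (?N - (?C \<union> U)) + card (?C \<union> U)"
    by (rule order_trans[OF card_mono card_Un_le]) auto
  moreover have "card (?C \<union> U) \<le> card ?C + card U" by (rule card_Un_le)
  ultimately have N': "card ?N \<le> card ?n + card ?C + card U" by linarith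
  have H: "card ?H = card ?n + card ?c"
    using card_Int_Diff[of ?H "Pow ?C"] by (simp add: Int_def set_diff_eq Pow_def)
  have "card (killed i j) \<le> card (Pair j ` near j i \<union> (\<lambda>a. (a, i)) ` near i j) + card (cross i j)"
    unfolding killed_def by (rule card_Un_le)
  also have "card (Pair j ` near j i \<union> (\<lambda>a. (a, i)) ` near i j) \<le>
      card (Pair j ` near j i) + card ((\<lambda>a. (a, i)) ` near i j)" by (rule card_Un_le)
  also have "\<dots> \<le> card (near j i) + card (near i j)" by (intro add_mono card_image_le) auto
  finally have K: "card (killed i j) \<le> card ?N + card ?C + card (cross i j)" using N by linarith
  let ?D = "{(i, j), (j, i)} \<union> killed i j"
  have "arcs \<subseteq> nbrs (i, j) \<union> ?D" by (auto simp: nbrs_def)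
  then have "card arcs \<le> card (nbrs (i, j) \<union> ?D)" by (intro card_mono) auto
  moreover have "card (nbrs (i, j) \<union> ?D) \<le> card (nbrs (i, j)) + card ?D" by (rule card_Un_le)
  moreover have "card ?D \<le> card {(i, j), (j, i)} + card (killed i j)" by (rule card_Un_le)
  moreover have "card {(i, j), (j, i)} \<le> 2" using card_length[of "[(i, j), (j, i)]"] by simp
  ultimately have "card arcs \<le> card (nbrs (i, j)) + 2 + card (killed i j)" by linarith
  \<comment> \<open>In total at most \<open>2 * card ?C + 2 * card ?H + card U\<close> arcs are
    killed, to be compared with twice the bound \<open>E\<close>.\<close>
  then show ?thesis using E N' H K card_cross[of i j] card_arcs by linarith
qed

section \<open>Short cycles through two different edges\<close>

text \<open>A necessary condition for \<open>{u, v} \<in> support x y\<close> that reduces the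
  comparison of two edges to a finite case analysis on adjacencies.\<close>

definition meets :: "'n \<Rightarrow> 'n \<Rightarrow> 'n \<Rightarrow> 'n \<Rightarrow> bool" where
  "meets x y u v \<longleftrightarrow> u = x \<or> u = y \<or> v = x \<or> v = y \<or> adj x u \<and> adj y v \<or> adj x v \<and> adj y u"

lemma support_meets:
  assumes "{u, v} \<in> support x y"
  shows "meets x y u v"
proof -
  have "meets x y u v" if cr: "{u, v} \<in> cross_edges x y"
  proof -
    obtain k l where "{u, v} = {k, l}" "adj x l" "adj y k"
      using cr by (auto simp: cross_edges_def cross_def)
    then show ?thesis by (auto simp: meets_def doubleton_eq_iff)
  qed
  then show ?thesis using assms by (auto simp: support_def meets_def doubleton_eq_iff)
qed

lemma meets_commute: "meets x y u v \<longleftrightarrow> meets y x u v"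
  by (auto simp: meets_def)

text \<open>Two paths \<open>i, a, b, j\<close> and \<open>i, a', b', j\<close> in different groups (the second one possibly with
  \<open>a' = b'\<close>, coming from a triangle) are not both covered by the short cycles through
  another edge \<open>{x, y}\<close>.\<close>

lemma separated_paths:
  assumes xy: "adj x y" "{x, y} \<noteq> {i, j}" and ij: "adj i j"
    and ab: "adj i a" "adj a b" "adj j b" "\<not> adj j a" "\<not> adj i b" "a \<noteq> j" "b \<noteq> i"
    and ab': "adj i a'" "adj j b'" "a' \<noteq> j" "b' \<noteq> i"
    and sep: "\<not> adj a b'" "\<not> adj b a'" "a \<noteq> a'" "a \<noteq> b'" "b \<noteq> a'" "b \<noteq> b'"
    and C: "\<And>z. adj i z \<Longrightarrow> adj j z \<Longrightarrow> \<not> adj z a \<and> \<not> adj z b"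
    and I: "\<And>z. z \<noteq> j \<Longrightarrow> adj i z \<Longrightarrow> adj z b \<Longrightarrow> \<not> adj z b' \<and> z \<noteq> b'"
    and J: "\<And>z. z \<noteq> i \<Longrightarrow> adj j z \<Longrightarrow> adj z a \<Longrightarrow> \<not> adj z a' \<and> z \<noteq> a'"
    and m: "meets x y i a" "meets x y a b" "meets x y b j" "meets x y i a'" "meets x y b' j"
  shows False
proof -
  have ne: "i \<noteq> j" "a \<noteq> i" "b \<noteq> j" "a \<noteq> b" "a' \<noteq> i" "b' \<noteq> j" "x \<noteq> y"
    using ij ab ab' xy adj_irrefl adj_sym by metis+
  have through_i: False if x: "adj i x" "x \<noteq> j" "meets i x a b" "meets i x b' j" for x
  proof -
    have "a = x \<or> adj x b" using x ab ne by (auto simp: meets_def)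
    then show False
    proof
      assume "a = x"
      then show False using x(4) ab ab' sep ne adj_sym[of a j] by (auto simp: meets_def)
    next
      assume xb: "adj x b"
      then have "adj x j" using I[OF x(2,1) xb] x(2,4) ab' ne by (auto simp: meets_def)
      then show False using C[OF x(1)] xb adj_sym by metis
    qed
  qed
  have through_j: False if y: "adj j y" "y \<noteq> i" "meets j y a b" "meets j y i a'" for y
  proof -
    have "b = y \<or> adj y a" using y ab ne by (auto simp: meets_def)
    then show False
    proof
      assume "b = y"
      then show False using y(4) ab ab' sep ne adj_sym[of b i] by (auto simp: meets_def)
    next
      assume ya: "adj y a"
      then have "adj y i" using J[OF y(2,1) ya] y(2,4) ab' ne by (auto simp: meets_def)
      then show False using C[OF _ y(1)] ya adj_sym by metis
    qed
  qed
  have through_a: False if "adj a y" "y \<noteq> j" "meets a y b' j" for y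
    using that sep ab ab' ne adj_sym[of a j] by (auto simp: meets_def)
  have through_b: False if "adj b y" "y \<noteq> i" "meets b y i a'" for y
    using that sep ab ab' ne adj_sym[of b i] by (auto simp: meets_def)
  \<comment> \<open>Off the path i, a, b, j, the edge must lie opposite to all three path edges;
    with \<open>C\<close> this joins x to i and b, and y to a and j. Covering {i, a'} then leaves
    only x = a', against \<open>sep\<close>.\<close>
  have avoiding: False
    if xy: "{x, y} \<inter> {i, j, a, b} = {}" "adj x i" "adj y a" 
      and m: "meets x y a b" "meets x y b j" "meets x y i a'" for x y
  proof -
    have "adj x a \<or> adj x b" "adj x b \<and> adj y j \<or> adj x j \<and> adj y b"
      using m(1,2) xy(1) by (auto simp: meets_def)
    then have x: "adj x b" "adj y j" using C[of x] xy(2) adj_sym by metis+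
    have "\<not> adj y a'" "y \<noteq> a'" using J[of y] x(2) xy adj_sym by auto
    moreover have "\<not> adj y i" using C[of y] x(2) xy(3) adj_sym by metis
    ultimately have "a' = x" using m(3) xy(1) ne by (auto simp: meets_def)
    then show False using x(1) sep(2) adj_sym by metis
  qed
  consider "x = i" | "y = i" | "x = j" | "y = j" | "x = a" | "y = a" | "x = b" | "y = b"
    | "{x, y} \<inter> {i, j, a, b} = {}" by auto
  then show False
  proof cases
    case 1 then show False using through_i[of y] xy m by auto
  next
    case 2 then show False using through_i[of x] xy m meets_commute adj_sym by (metis insert_commute)
  next
    case 3 then show False using through_j[of y] xy m by (metis insert_commute)
  next
    case 4 then show False using through_j[of x] xy m meets_commute adj_sym by metis
  next
    case 5 then show False using through_a[of y] xy m ab adj_sym by metis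
  next
    case 6 then show False using through_a[of x] xy m ab adj_sym meets_commute by metis
  next
    case 7 then show False using through_b[of y] xy m ab adj_sym by metis
  next
    case 8 then show False using through_b[of x] xy m ab adj_sym meets_commute by metis
  next
    case 9
    then have "adj x i \<and> adj y a \<or> adj y i \<and> adj x a" using m(1) by (auto simp: meets_def)
    then show False
      using avoiding[of x y] avoiding[of y x] 9 m meets_commute by (metis insert_commute)
  qed
qed

text \<open>Each element of \<open>U\<close>, and one common neighbour if there is any, gives a path
  from i to j closed by {i, j}; these paths are edge-disjoint because they lie in different classes
  of \<open>reach\<close>. By \<open>separated_paths\<close> at most one is covered by
  \<open>support x y\<close>. Every other one loses an edge outside that support, and the rest of
  its cycle bypasses the gap.\<close>

lemma exists_removable_edges:
  assumes conn: "connected_graph E" and ij: "adj i j" and U: "transversal i j U"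
    and xy: "adj x y" "{x, y} \<noteq> {i, j}"
  shows "\<exists>T\<subseteq>E. connected_graph (E - T) \<and> T \<inter> support x y = {} \<and>
    card U + (if common i j = {} then 0 else 1) \<le> card T + 1"
proof -
  have U': "U \<subseteq> near i j" "\<And>u v. u \<in> U \<Longrightarrow> v \<in> U \<Longrightarrow> (u, v) \<in> reach i j \<Longrightarrow> u = v"
    "\<And>u c. u \<in> U \<Longrightarrow> c \<in> common i j \<Longrightarrow> (c, u) \<notin> reach i j"
    using U by (auto simp: transversal_def)
  have flip: "(v, u) \<in> reach i j" if "(u, v) \<in> reach i j" for u v
    using that sym_reach by (auto dest: symD)
  have UC: "U \<inter> common i j = {}" using U'(3) reach_refl by blast
  have "\<exists>b. b \<noteq> i \<and> adj j b \<and> adj a b" if a: "a \<in> U" for a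
  proof -
    have "a \<in> near i j" "a \<notin> common i j" using a U'(1) UC by auto
    then show ?thesis using adj_sym by (auto simp: near_def common_def)
  qed
  then obtain b where b: "\<And>a. a \<in> U \<Longrightarrow> b a \<noteq> i" "\<And>a. a \<in> U \<Longrightarrow> adj j (b a)"
      "\<And>a. a \<in> U \<Longrightarrow> adj a (b a)"
    by metis
  have a: "adj i a" "a \<noteq> j" "\<not> adj j a" if "a \<in> U" for a
    using that U'(1) UC by (auto simp: near_def common_def)
  have rb: "(a, b a) \<in> reach i j" if "a \<in> U" for a
    using cross_step(1)[of i a j "b a"] a[OF that] b[OF that] by simp
  have nb: "\<not> adj i (b a)" if "a \<in> U" for a
    using U'(3)[OF that, of "b a"] rb[OF that] b[OF that] flip by (auto simp: common_def)
  have rC: "(c, z) \<notin> reach i j" if "c \<in> common i j" "a \<in> U" "z \<in> {a, b a}" for a c z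
    using that U'(3) rb flip reach_trans by (metis empty_iff insert_iff)
  obtain K where K: "K \<subseteq> common i j" "card K = (if common i j = {} then 0 else 1)"
  proof (cases "common i j = {}")
    case True
    then show thesis using that[of "{}"] by simp
  next
    case False
    then obtain c where "c \<in> common i j" by blast
    then show thesis using that[of "{c}"] False by simp
  qed
  have K1: "c = c'" if "c \<in> K" "c' \<in> K" for c c'
    using that K(2) card_le_Suc0_iff_eq[of K] by (auto split: if_splits)
  \<comment> \<open>The pair \<open>(c, c)\<close> encodes the path i, c, j of a triangle; its
    degenerate middle edge {c} is dropped in \<open>Q\<close> by the intersection with
    \<open>E\<close>.\<close>
  define P where "P = (\<lambda>a. (a, b a)) ` U \<union> (\<lambda>c. (c, c)) ` K"
  have cardP: "card P = card U + (if common i j = {} then 0 else 1)"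
  proof -
    have "card P = card ((\<lambda>a. (a, b a)) ` U) + card ((\<lambda>c. (c, c)) ` K)"
      unfolding P_def using UC K(1) by (intro card_Un_disjoint) auto
    then show ?thesis using K(2) by (simp add: card_image inj_on_def)
  qed
  have P: "adj i p" "p \<noteq> j" "adj j q" "q \<noteq> i" "p = q \<or> adj p q" if "(p, q) \<in> P" for p q
    using that a b K(1) adj_irrefl unfolding P_def common_def by auto
  have apart: "(z, z') \<notin> reach i j"
    if A: "a \<in> U" and pq: "(p, q) \<in> P" "(p, q) \<noteq> (a, b a)" and z: "z \<in> {a, b a}" "z' \<in> {p, q}"
    for a p q z z'
  proof
    assume r: "(z, z') \<in> reach i j"
    have "(a, z') \<in> reach i j" using r z(1) rb[OF A] reach_trans by auto
    consider "p \<in> U" "q = b p" | "p \<in> common i j" "q = p" using pq(1) K(1) unfolding P_def by auto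
    then show False
    proof cases
      case 1
      then have "(a, p) \<in> reach i j" using \<open>(a, z') \<in> reach i j\<close> z(2) rb flip reach_trans by blast
      then show False using U'(2)[OF A 1(1)] pq(2) 1 by auto
    next
      case 2
      then show False using rC[OF 2(1) A, of a] \<open>(a, z') \<in> reach i j\<close> z(2) flip by auto
    qed
  qed
  define Q where "Q = (\<lambda>(p, q). {{i, p}, {p, q}, {q, j}} \<inter> E)"
  have not_both: False
    if A: "a \<in> U" and pq: "(p, q) \<in> P" "(p, q) \<noteq> (a, b a)"
      and Qs: "Q (a, b a) \<subseteq> support x y" "Q (p, q) \<subseteq> support x y" for a p q
  proof (rule separated_paths[OF xy ij a(1)[OF A] b(3)[OF A] b(2)[OF A] a(3)[OF A] nb[OF A] a(2)[OF A]
        b(1)[OF A] P(1)[OF pq(1)] P(3)[OF pq(1)] P(2)[OF pq(1)] P(4)[OF pq(1)]])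
    note ap = apart[OF A pq]
    note step = cross_step[of i _ j]
    show "\<not> adj a q" using ap[of a q] step(1)[of a q] a[OF A] P[OF pq(1)] by auto
    show "\<not> adj (b a) p"
      using ap[of "b a" p] step(2)[of p "b a"] b[OF A] P[OF pq(1)] adj_sym by auto
    show "a \<noteq> p" "a \<noteq> q" "b a \<noteq> p" "b a \<noteq> q"
      using ap[of a p] ap[of a q] ap[of "b a" p] ap[of "b a" q] reach_refl by auto
    show "\<not> adj z a \<and> \<not> adj z (b a)" if z: "adj i z" "adj j z" for z
    proof -
      have "z \<noteq> i" "z \<noteq> j" "z \<in> common i j" using z adj_irrefl by (auto simp: common_def)
      then show ?thesis
        using rC[of z a a] rC[of z a "b a"] A step(2)[of a z] step(1)[of z "b a"] z a[OF A] b[OF A] adj_sym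
        by auto
    qed
    show "\<not> adj z q \<and> z \<noteq> q" if z: "z \<noteq> j" "adj i z" "adj z (b a)" for z
    proof -
      have "(b a, z) \<in> reach i j" using step(2)[of z "b a"] z b[OF A] by auto
      then show ?thesis
        using ap[of "b a" q] step(1)[of z q] z P[OF pq(1)] reach_trans by blast
    qed
    show "\<not> adj z p \<and> z \<noteq> p" if z: "z \<noteq> i" "adj j z" "adj z a" for z
    proof -
      have "(a, z) \<in> reach i j" using step(1)[of a z] z a[OF A] adj_sym by auto
      moreover have "(z, p) \<in> reach i j" if "adj z p"
        using step(2)[of p z] z P[OF pq(1)] that adj_sym by auto
      ultimately show ?thesis using ap[of a p] reach_trans by blast
    qed
    show "meets x y i a" "meets x y a (b a)" "meets x y (b a) j"
      using Qs(1) a[OF A] b[OF A] adj_sym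
      by (auto intro!: support_meets simp: Q_def adj_def)
    show "meets x y i p" "meets x y q j"
      using Qs(2) P[OF pq(1)] adj_sym
      by (auto intro!: support_meets simp: Q_def adj_def)
  qed
  define B where "B = {s \<in> P. Q s \<subseteq> support x y}"
  have "card B \<le> 1"
  proof -
    have "s = s'" if sB: "s \<in> B" "s' \<in> B" for s s'
    proof (rule ccontr)
      assume ne: "s \<noteq> s'"
      have ss: "s \<in> P" "s' \<in> P" "Q s \<subseteq> support x y" "Q s' \<subseteq> support x y"
        using sB by (auto simp: B_def)
      \<comment> \<open>\<open>K\<close> has at most one element, so one of two distinct pairs comes
        from \<open>U\<close>, as \<open>not_both\<close> requires.\<close>
      consider a where "a \<in> U" "s = (a, b a)" | a where "a \<in> U" "s' = (a, b a)"
        | c c' where "c \<in> K" "c' \<in> K" "s = (c, c)" "s' = (c', c')"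
        using ss(1,2) unfolding P_def by blast
      then show False
      proof cases
        case 1
        then show False using not_both[of a "fst s'" "snd s'"] ss ne by auto
      next
        case 2
        then show False using not_both[of a "fst s" "snd s"] ss ne by auto
      next
        case 3
        then show False using K1 ne by blast
      qed
    qed
    then show ?thesis using card_le_Suc0_iff_eq[of B] by auto
  qed
  have "\<forall>s\<in>P - B. \<exists>g. g \<in> Q s \<and> g \<notin> support x y" by (auto simp: B_def)
  then obtain g where g: "\<And>s. s \<in> P - B \<Longrightarrow> g s \<in> Q s \<and> g s \<notin> support x y" by metis
  define T where "T = g ` (P - B)"
  have disj: "Q s \<inter> Q s' = {}" if ss: "s \<in> P" "s' \<in> P" "s \<noteq> s'" for s s'
  proof -
    obtain p q p' q' where s: "s = (p, q)" "s' = (p', q')" by (metis surj_pair)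
    have "p \<noteq> p' \<and> p \<noteq> q' \<and> q \<noteq> p' \<and> q \<noteq> q'"
    proof -
      consider a where "a \<in> U" "s = (a, b a)" | a where "a \<in> U" "s' = (a, b a)"
        | c c' where "c \<in> K" "c' \<in> K" "s = (c, c)" "s' = (c', c')"
        using ss unfolding P_def by blast
      then show ?thesis
      proof cases
        case 1
        then show ?thesis using apart[of a p' q'] ss s reach_refl by fastforce
      next
        case 2
        then show ?thesis using apart[of a p q] ss s reach_refl by fastforce
      next
        case 3
        then show ?thesis using K1 ss(3) by blast
      qed
    qed
    moreover have "p \<noteq> i" "q \<noteq> j" "p' \<noteq> i" "q' \<noteq> j" "p \<noteq> j" "q \<noteq> i" "p' \<noteq> j" "q' \<noteq> i" "i \<noteq> j"
      using P[of p q] P[of p' q'] ss s ij adj_irrefl by auto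
    ultimately show ?thesis unfolding s Q_def by (auto simp: doubleton_eq_iff)
  qed
  have TE: "T \<subseteq> E" using g by (auto simp: T_def Q_def)
  have inj: "inj_on g (P - B)"
  proof (rule inj_onI)
    fix s s' assume "s \<in> P - B" "s' \<in> P - B" "g s = g s'"
    then show "s = s'" using g[of s] g[of s'] disj[of s s'] by auto
  qed
  have "card P - card B \<le> card T"
    unfolding T_def card_image[OF inj] by (rule diff_card_le_card_Diff) simp
  then have cardT: "card P \<le> card T + 1" using \<open>card B \<le> 1\<close> by simp
  let ?F = "{(u, v). {u, v} \<in> E - T}\<^sup>*"
  have symF: "(v, u) \<in> ?F" if "(u, v) \<in> ?F" for u v
  proof -
    have "sym ?F" by (intro sym_rtrancl) (auto simp: sym_def insert_commute)
    then show ?thesis using that by (auto dest: symD)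
  qed
  \<comment> \<open>The bypass of a removed edge survives: {i, j} lies in no \<open>Q s\<close>, and
    the disjoint sets \<open>Q s\<close> lose at most one edge each.\<close>
  have step: "(u, v) \<in> ?F" if uv: "adj u v" for u v
  proof (cases "{u, v} \<in> T")
    case False
    then show ?thesis using uv by (auto simp: adj_def)
  next
    case True
    then obtain s where s: "s \<in> P - B" "{u, v} = g s" by (auto simp: T_def)
    obtain p q where pq: "s = (p, q)" by (metis surj_pair)
    have pqP: "(p, q) \<in> P" using s pq by simp
    have ne: "p \<noteq> i" "q \<noteq> j" "p \<noteq> j" "q \<noteq> i" "i \<noteq> j" using P[OF pqP] ij adj_irrefl by auto
    have keep: "h \<in> E - T" if "h \<in> Q s" "h \<noteq> g s" for h
    proof -
      have "h \<noteq> g s'" if "s' \<in> P - B" for s'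
        using that \<open>h \<in> Q s\<close> \<open>h \<noteq> g s\<close> g[OF that] disj[of s s'] s(1) by auto
      then show ?thesis using that(1) unfolding T_def by (auto simp: Q_def)
    qed
    have "{i, j} \<notin> Q s'" if "s' \<in> P" for s'
    proof -
      obtain p q where "s' = (p, q)" by (metis surj_pair)
      moreover from this have "p \<noteq> i" "q \<noteq> j" "p \<noteq> j" "q \<noteq> i" using P[of p q] that adj_irrefl by auto
      ultimately show ?thesis by (auto simp: Q_def doubleton_eq_iff)
    qed
    then have "{i, j} \<notin> T" using g unfolding T_def by (metis DiffD1 imageE)
    then have "{i, j} \<in> E - T" using ij by (simp add: adj_def)
    then have Fij: "(i, j) \<in> ?F" by blast
    have ip: "(i, p) \<in> ?F" if "{i, p} \<noteq> g s"
      using keep[of "{i, p}"] that P[OF pqP] by (auto simp: Q_def pq adj_def)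
    have pq': "(p, q) \<in> ?F" if "{p, q} \<noteq> g s"
      using keep[of "{p, q}"] that P[OF pqP] by (auto simp: Q_def pq adj_def)
    have qj: "(q, j) \<in> ?F" if "{q, j} \<noteq> g s"
      using keep[of "{q, j}"] that P[OF pqP] adj_sym[of j q] by (auto simp: Q_def pq adj_def)
    have "g s \<in> {{i, p}, {p, q}, {q, j}}" using g[OF s(1)] by (auto simp: Q_def pq)
    then consider "g s = {i, p}" | "g s = {p, q}" | "g s = {q, j}" by auto
    then have "(i, p) \<in> ?F \<and> (p, q) \<in> ?F \<and> (q, j) \<in> ?F"
    proof cases
      case 1
      then have "(p, q) \<in> ?F" "(q, j) \<in> ?F" using pq' qj ne by (auto simp: doubleton_eq_iff)
      then show ?thesis using Fij symF by (meson rtrancl_trans)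
    next
      case 2
      then have "(i, p) \<in> ?F" "(q, j) \<in> ?F" using ip qj ne by (auto simp: doubleton_eq_iff)
      then show ?thesis using Fij symF by (meson rtrancl_trans)
    next
      case 3
      then have "(i, p) \<in> ?F" "(p, q) \<in> ?F" using ip pq' ne by (auto simp: doubleton_eq_iff)
      then show ?thesis using Fij symF by (meson rtrancl_trans)
    qed
    moreover have "{u, v} = {i, p} \<or> {u, v} = {p, q} \<or> {u, v} = {q, j}"
      using s(2) \<open>g s \<in> _\<close> by simp
    ultimately show ?thesis using symF by (auto simp: doubleton_eq_iff)
  qed
  have "connected_graph (E - T)"
    unfolding connected_graph_def
  proof (intro allI)
    fix u v
    have "(u, v) \<in> {(i, j). {i, j} \<in> E}\<^sup>*" using conn by (simp add: connected_graph_def)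
    then show "(u, v) \<in> ?F"
    proof (induction rule: rtrancl_induct)
      case (step v w)
      then show ?case using \<open>\<And>u v. adj u v \<Longrightarrow> (u, v) \<in> ?F\<close>[of v w] by (auto simp: adj_def)
    qed simp
  qed
  moreover have "T \<inter> support x y = {}" using g by (auto simp: T_def)
  ultimately show ?thesis using TE cardT unfolding cardP by blast
qed

section \<open>Averaging over all arcs\<close>

lemma mem_triangle_edges: "{i, j} \<in> triangle_edges E \<longleftrightarrow> adj i j \<and> common i j \<noteq> {}"
proof
  assume "{i, j} \<in> triangle_edges E"
  then obtain p q r where "{p, q} \<in> E" "{q, r} \<in> E" "{p, r} \<in> E" "{i, j} \<in> E"
      "{i, j} = {p, q} \<or> {i, j} = {q, r} \<or> {i, j} = {p, r}"
    by (auto simp: triangle_edges_def)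
  then show "adj i j \<and> common i j \<noteq> {}"
    by (auto simp: adj_def common_def doubleton_eq_iff insert_commute)
next
  assume "adj i j \<and> common i j \<noteq> {}"
  then obtain k where k: "adj i j" "adj j k" "adj i k" by (auto simp: common_def)
  then have "i \<noteq> j" "j \<noteq> k" "i \<noteq> k" using adj_irrefl by auto
  then show "{i, j} \<in> triangle_edges E"
    using k unfolding triangle_edges_def adj_def by blast
qed

lemma sum_degree_ge:
  assumes conn: "connected_graph E"
  shows "(\<Sum>(i, j)\<in>arcs. int (card (nbrs (i, j)))) \<ge>
    (\<Sum>(i, j)\<in>arcs. 2 * int CARD('n) - 5 + of_bool (common i j \<noteq> {}))"
proof -
  define U where "U i j = (SOME U. transversal i j U)" for i j
  have U: "transversal i j (U i j)" for i j
    unfolding U_def using exists_transversal_near by (rule someI_ex)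
  \<comment> \<open>\<open>K\<close> is one more than the possible deficit k, and \<open>d\<close>
    is the surplus over the desired average.\<close>
  define K where "K = (\<lambda>(i, j). int (card (U i j)) + of_bool (common i j \<noteq> {}))"
  define d where "d = (\<lambda>(i, j). int (card (nbrs (i, j))) - (2 * int CARD('n) - 5 + of_bool (common i j \<noteq> {})))"
  have d: "d (x, y) \<ge> 2 * int (card T) + 1 - K (x, y)"
    if "(x, y) \<in> arcs" "T \<subseteq> E" "T \<inter> support x y = {}" "connected_graph (E - T)" for x y T
    using degree_bound[of x y, OF _ U that(2-4)] that(1) by (simp add: d_def K_def mem_arcs)
  have d0: "d f \<ge> 1 - K f" if "f \<in> arcs" for f
    using d[of "fst f" "snd f" "{}"] that conn by simp
  have "sum d arcs \<ge> 0"
  proof (cases "\<forall>f\<in>arcs. K f \<le> 1")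
    case True
    then show ?thesis using d0 by (intro sum_nonneg) force
  next
    case False
    then have ne: "arcs \<noteq> {}" by auto
    \<comment> \<open>\<open>U\<close> is chosen separately for the two orientations of an edge, so
      the maximum runs over arcs and also bounds the value at \<open>(j, i)\<close>.\<close>
    then have "Max (K ` arcs) \<in> K ` arcs" by (intro Max_in) auto
    then obtain e where "e \<in> arcs" "Max (K ` arcs) = K e" by auto
    then have e: "e \<in> arcs" "\<And>f. f \<in> arcs \<Longrightarrow> K f \<le> K e"
      using Max_ge[of "K ` arcs"] by auto
    obtain i j where eij: "e = (i, j)" by (cases e)
    have ij: "adj i j" "adj j i" "i \<noteq> j" using e(1) eij adj_sym adj_irrefl by (auto simp: mem_arcs)
    have K2: "K e \<ge> 2" using False e(2) by force
    let ?D = "{(i, j), (j, i)}"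
    \<comment> \<open>At least \<open>K e - 1\<close> edges are removable, so \<open>d f\<close> is
      at least \<open>2 * (K e - 1) + 1 - K f\<close>, where \<open>K f\<close> is at most
      \<open>K e\<close>.\<close>
    have rest: "d f \<ge> K e - 1" if f: "f \<in> arcs - ?D" for f
    proof -
      obtain x y where xy: "f = (x, y)" by (cases f)
      have "adj x y" "{x, y} \<noteq> {i, j}" using f xy by (auto simp: mem_arcs doubleton_eq_iff)
      then obtain T where "T \<subseteq> E" "connected_graph (E - T)" "T \<inter> support x y = {}"
          "card (U i j) + (if common i j = {} then 0 else 1) \<le> card T + 1"
        using exists_removable_edges[OF conn ij(1) U] by blast
      then show ?thesis
        using d[of x y T] e(2)[of f] f xy eij by (auto simp: K_def split: if_splits)
    qed
    \<comment> \<open>A triangle adds only 1 to \<open>K e\<close>, so \<open>U i j\<close> is not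
      empty and {i, a} is another edge; its two arcs pay for \<open>(i, j)\<close> and
      \<open>(j, i)\<close>.\<close>
    have "card (U i j) \<noteq> 0" using K2 by (auto simp: K_def eij of_bool_def split: if_splits)
    then obtain a where "a \<in> U i j" by (auto simp: card_eq_0_iff)
    then have a: "adj i a" "a \<noteq> j" using U[of i j] by (auto simp: transversal_def near_def)
    have "i \<noteq> a" using a(1) adj_irrefl by auto
    have "{(i, a), (a, i)} \<subseteq> arcs - ?D" using a \<open>i \<noteq> a\<close> adj_sym ij by (auto simp: mem_arcs)
    then have "card {(i, a), (a, i)} \<le> card (arcs - ?D)" by (intro card_mono) auto
    then have two: "2 \<le> int (card (arcs - ?D))" using \<open>i \<noteq> a\<close> by simp
    have "2 * (K e - 1) \<le> int (card (arcs - ?D)) * (K e - 1)"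
      using two K2 by (intro mult_right_mono) auto
    also have "\<dots> = (\<Sum>f\<in>arcs - ?D. K e - 1)" by simp
    also have "\<dots> \<le> sum d (arcs - ?D)" using rest by (rule sum_mono)
    finally have "2 * (K e - 1) \<le> sum d (arcs - ?D)" .
    moreover have "d (i, j) \<ge> 1 - K e" "d (j, i) \<ge> 1 - K e"
      using d0[of "(i, j)"] d0[of "(j, i)"] e(2)[of "(j, i)"] ij eij by (auto simp: mem_arcs)
    moreover have "sum d arcs = sum d (arcs - ?D) + (d (i, j) + d (j, i))"
      using ij sum.subset_diff[of ?D arcs d] by (simp add: mem_arcs)
    ultimately show ?thesis by (smt (verit))
  qed
  then show ?thesis by (simp add: d_def sum_subtractf case_prod_unfold)
qed

text \<open>The sum over arcs doubles every term, so the factor 2 cancels. Integers matter because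
  \<open>2 * CARD('n) - 5\<close> is negative for at most two vertices.\<close>

lemma num_edges_bound:
  assumes "connected_graph E"
  shows "int (num_edges (symmetric_edge_polytope E))
    \<ge> int (card E) * (2 * int CARD('n) - 5) + int (card (triangle_edges E))"
proof -
  have "(\<Sum>(i, j)\<in>arcs. of_bool (common i j \<noteq> {})) = int (card (arcs \<inter> {(i, j). common i j \<noteq> {}}))"
    by (subst sum_of_bool_eq[symmetric]) (auto simp: case_prod_unfold)
  also have "arcs \<inter> {(i, j). common i j \<noteq> {}} = {(i, j). {i, j} \<in> triangle_edges E}"
    by (auto simp: mem_triangle_edges mem_arcs)
  also have "card \<dots> = 2 * card (triangle_edges E)"
    using simple by (intro card_ordered_pairs) (auto simp: triangle_edges_def simple_graph_def)
  finally have t: "(\<Sum>(i, j)\<in>arcs. of_bool (common i j \<noteq> {})) = 2 * int (card (triangle_edges E))" by simp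
  have "2 * int (card E) * (2 * int CARD('n) - 5) + 2 * int (card (triangle_edges E)) =
      (\<Sum>(i, j)\<in>arcs. 2 * int CARD('n) - 5 + of_bool (common i j \<noteq> {}))"
    using t by (simp add: case_prod_unfold sum.distrib card_arcs)
  also have "\<dots> \<le> int (\<Sum>\<alpha>\<in>arcs. card (nbrs \<alpha>))"
    using sum_degree_ge[OF assms] by (simp add: case_prod_unfold)
  also have "\<dots> \<le> 2 * int (num_edges (symmetric_edge_polytope E))"
    using sum_nbrs_le_num_edges by linarith
  finally show ?thesis by (simp add: algebra_simps)
qed

end

theorem theorem3p1:
  fixes E :: "'n::finite set set"
  assumes "simple_graph E" and "connected_graph E"
  shows "int (num_edges (symmetric_edge_polytope E))
    \<ge> int (card E) * (2 * int CARD('n) - 5) + int (card (triangle_edges E))"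
  using assms by (intro finite_graph.num_edges_bound finite_graph.intro)

end
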